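(* Let $M\in\mathbb{R}^{m\times n}$ with $m\le n$ and $\operatorname{rank}(M)=r$. Let $\{p_i\}_{i=1}^n$ be a probability distribution on $[n]$ with $p_i>0$ for all $i$, and let $p_{\min}=\min_{i\in[n]}p_i$. Let $\delta\in(0,1)$. Suppose that Algorithm MC-NUS (described in the context) is run on $M$ with target rank $r$, $d$ sampled columns, sampling distribution $\{p_i\}$, and $s$ sampled entries per remaining column, where $$d\ \ge\ \frac{7\mu(r)\,r\ln(2r/\delta)}{n\,p_{\min}},\qquad s\ \ge\ 7\mu(r)\,r\ln(2rn/\delta).$$ Then with probability at least $1-\delta$ (over the random sampling of the algorithm), the output satisfies $\hat M=M$, i.e. the algorithm recovers $M$ exactly.
   Context: Notation: for a matrix $B$, $B_{(i)}$ is its $i$-th row and $B^{(j)}$ its $j$-th column; for a (multi)set $\mathcal{O}$ of row indices, $\mathbf{x}_{\mathcal{O}}$ is the vector of entries of $\mathbf{x}$ indexed by $\mathcal{O}$ and $B_{\mathcal{O}}$ is the matrix of rows of $B$ indexed by $\mathcal{O}$ (with repetitions if $\mathcal{O}$ has repeated indices). Write $M=[\mathbf{m}_1,\dots,\mathbf{m}_n]$. Algorithm MC-NUS (inputs: target rank $r>0$, integers $d\ge r$, $s>0$, distribution $\{p_i\}_{i=1}^n$ with $p_i>0$): (1) For $j=1,\dots,d$, independently sample $i_j\in[n]$ with $\Pr[i_j=i]=p_i$; set $\hat{\mathbf{m}}_{i_j}=\mathbf{m}_{i_j}$ (these columns are fully observed) and $A^{(j)}=\mathbf{m}_{i_j}/\sqrt{d\,p_{i_j}}$,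 giving $A\in\mathbb{R}^{m\times d}$. (2) Set $\hat r=\min(r,\operatorname{rank}(A))$ and let $\hat U\in\mathbb{R}^{m\times\hat r}$ consist of the top-$\hat r$ left singular vectors of $A$. (3) For each remaining column $\mathbf{m}_i$ (not among the sampled ones), sample a multiset $\mathcal{O}_i$ of $s$ indices uniformly at random from $[m]$ with replacement, observe $\mathbf{m}_{i,\mathcal{O}_i}$, and set $\hat{\mathbf{m}}_i=\hat U(\hat U_{\mathcal{O}_i}^T\hat U_{\mathcal{O}_i})^{-1}\hat U_{\mathcal{O}_i}^T\mathbf{m}_{i,\mathcal{O}_i}$. Output $\hat M=[\hat{\mathbf{m}}_1,\dots,\hat{\mathbf{m}}_n]$. Incoherence: let $\bar U\in\mathbb{R}^{m\times r}$, $\bar V\in\mathbb{R}^{n\times r}$ be the matrices of top-$r$ left and right singular vectors of $M$; $\mu(r)=\max\left(\max_{i\in[m]}\frac{m}{r}\|\bar U_{(i)}\|_2^2,\ \max_{i\in[n]}\frac{n}{r}\|\bar V_{(i)}\|_2^2\right)$. *)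

theory Defs
  imports "Jordan_Normal_Form.DL_Rank" "HOL-Probability.Product_PMF"
begin

definition mrank :: "real mat \<Rightarrow> nat" where
  "mrank A = vec_space.rank (dim_row A) A"

definition is_svd :: "real mat \<Rightarrow> real mat \<Rightarrow> real mat \<Rightarrow> real mat \<Rightarrow> bool" where
  "is_svd A W S Z \<longleftrightarrow>
     (let k = dim_row A; l = dim_col A in
      A \<in> carrier_mat k l \<and>
      W \<in> carrier_mat k k \<and> transpose_mat W * W = 1\<^sub>m k \<and>
      Z \<in> carrier_mat l l \<and> transpose_mat Z * Z = 1\<^sub>m l \<and>
      S \<in> carrier_mat k l \<and>
      (\<forall>i<k. \<forall>j<l. i \<noteq> j \<longrightarrow> S $$ (i, j) = 0) \<and>
      (\<forall>i<min k l. S $$ (i, i) \<ge> 0) \<and>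
      (\<forall>i j. i \<le> j \<longrightarrow> j < min k l \<longrightarrow> S $$ (j, j) \<le> S $$ (i, i)) \<and>
      A = W * S * transpose_mat Z)"

definition first_cols :: "nat \<Rightarrow> real mat \<Rightarrow> real mat" where
  "first_cols k W = Matrix.mat (dim_row W) k (\<lambda>(i, j). W $$ (i, j))"

definition top_left_sv :: "real mat \<Rightarrow> nat \<Rightarrow> real mat \<Rightarrow> bool" where
  "top_left_sv A k U \<longleftrightarrow> (\<exists>W S Z. is_svd A W S Z \<and> U = first_cols k W)"

definition row_sqnorm :: "real mat \<Rightarrow> nat \<Rightarrow> real" where
  "row_sqnorm B i = (\<Sum>j<dim_col B. (B $$ (i, j))\<^sup>2)"

definition incoherence :: "real mat \<Rightarrow> nat \<Rightarrow> real mat \<Rightarrow> real mat \<Rightarrow> real" where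
  "incoherence M r W Z =
     max (Max ((\<lambda>i. real (dim_row M) / real r * row_sqnorm (first_cols r W) i) ` {..<dim_row M}))
         (Max ((\<lambda>i. real (dim_col M) / real r * row_sqnorm (first_cols r Z) i) ` {..<dim_col M}))"

definition rows_sel :: "real mat \<Rightarrow> nat list \<Rightarrow> real mat" where
  "rows_sel B Ob = Matrix.mat (length Ob) (dim_col B) (\<lambda>(a, j). B $$ (Ob ! a, j))"

definition vec_sel :: "real Matrix.vec \<Rightarrow> nat list \<Rightarrow> real Matrix.vec" where
  "vec_sel x Ob = Matrix.vec (length Ob) (\<lambda>a. vec_index x (Ob ! a))"

definition sample_mat :: "real mat \<Rightarrow> nat pmf \<Rightarrow> nat \<Rightarrow> (nat \<Rightarrow> nat) \<Rightarrow> real mat" where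
  "sample_mat M P d idx =
     Matrix.mat (dim_row M) d (\<lambda>(i, j). M $$ (i, idx j) / sqrt (real d * pmf P (idx j)))"

text \<open>Step (3) for one column: the least-squares reconstruction is well defined
  (U_O^T U_O invertible) and equals the true column.\<close>
definition recon_ok :: "real mat \<Rightarrow> real mat \<Rightarrow> nat list \<Rightarrow> nat \<Rightarrow> bool" where
  "recon_ok M U Ob i \<longleftrightarrow>
     (let UO = rows_sel U Ob; G = transpose_mat UO * UO; k = dim_col U in
      \<exists>X. X \<in> carrier_mat k k \<and> G * X = 1\<^sub>m k \<and> X * G = 1\<^sub>m k \<and>
          U *\<^sub>v (X *\<^sub>v (transpose_mat UO *\<^sub>v vec_sel (Matrix.col M i) Ob)) = Matrix.col M i)"

text \<open>Success of MC-NUS for a given outcome of the random choices: idx j is the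
  column index i_j (j < d), and Os i is the list of s row indices sampled for
  column i. The output equals M for every admissible choice of the top singular
  vectors U-hat (the sampled columns are copied verbatim, hence exact).\<close>
definition mcnus_success ::
  "real mat \<Rightarrow> nat \<Rightarrow> nat \<Rightarrow> nat pmf \<Rightarrow> (nat \<Rightarrow> nat) \<Rightarrow> (nat \<Rightarrow> nat list) \<Rightarrow> bool" where
  "mcnus_success M r d P idx Os \<longleftrightarrow>
     (let A = sample_mat M P d idx; rh = min r (mrank A) in
      \<forall>U. top_left_sv A rh U \<longrightarrow>
        (\<forall>i<dim_col M. i \<notin> idx ` {..<d} \<longrightarrow> recon_ok M U (Os i) i))"

definition mcnus_space :: "nat \<Rightarrow> nat \<Rightarrow> nat \<Rightarrow> nat \<Rightarrow> nat pmf \<Rightarrow>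
    ((nat \<Rightarrow> nat) \<times> (nat \<Rightarrow> nat list)) pmf" where
  "mcnus_space m n d s P =
     pair_pmf (Pi_pmf {..<d} 0 (\<lambda>_. P))
              (Pi_pmf {..<n} [] (\<lambda>_. pmf_of_set {Ob. length Ob = s \<and> set Ob \<subseteq> {..<m}}))"

end

theory Submission
  imports Defs
begin

text \<open>
  No matrix concentration is needed, because exact recovery only asks that the sampled rows of the
  singular vector matrices span \<open>\<real>\<^sup>r\<close>. Let \<open>x\<^sub>i\<close> be the rows of a matrix with orthonormal
  columns, \<open>\<parallel>x\<^sub>i\<parallel>\<^sup>2 \<le> B\<close>, and let \<open>Q\<close> project onto the orthogonal complement, of dimension \<open>k\<close>, of
  the rows sampled so far. Then \<open>\<Sum>\<^sub>i \<parallel>Q x\<^sub>i\<parallel>\<^sup>2 = k\<close>, so at least \<open>k / B\<close> rows have \<open>Q x\<^sub>i \<noteq> 0\<close>, and the next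
  sample lowers \<open>k\<close> by one with probability at least \<open>k q / B\<close> if all probabilities are at least \<open>q\<close>.
  The expected codimension thus shrinks by a factor \<open>1 - q / B\<close> per sample, and Markov's inequality
  bounds the probability that \<open>d\<close> samples do not span by \<open>r exp (- d q / B)\<close>.

  Spanning rows of the right singular vectors give the column sample the column space of \<open>M\<close>;
  spanning rows of the left singular vectors make the least-squares problem of a column uniquely
  solvable. Both events refer to the fixed singular vectors of \<open>M\<close>, so a union bound finishes the
  proof without using independence of the two stages.
\<close>

section \<open>Projections onto the orthogonal complement of the sampled vectors\<close>

text \<open>A symmetric idempotent is an orthogonal projection, and its trace is its rank. The trace
  carries the dimension \<open>k\<close> without a theory of subspaces; only entries below
  \<open>r\<close> matter.\<close>

definition proj_mat :: "nat \<Rightarrow> nat \<Rightarrow> (nat \<Rightarrow> nat \<Rightarrow> real) \<Rightarrow> bool" where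
  "proj_mat r k Q \<longleftrightarrow>
     (\<forall>a<r. \<forall>b<r. Q a b = Q b a) \<and>
     (\<forall>a<r. \<forall>b<r. (\<Sum>c<r. Q a c * Q c b) = Q a b) \<and>
     (\<Sum>a<r. Q a a) = real k"

lemma proj_matD:
  assumes "proj_mat r k Q"
  shows "\<And>a b. a < r \<Longrightarrow> b < r \<Longrightarrow> Q a b = Q b a"
    and "\<And>a b. a < r \<Longrightarrow> b < r \<Longrightarrow> (\<Sum>c<r. Q a c * Q c b) = Q a b"
    and "(\<Sum>a<r. Q a a) = real k"
  using assms unfolding proj_mat_def by blast+

text \<open>By symmetry each inner sum is a diagonal entry of the square of \<open>Q\<close>, which
  is \<open>Q\<close>, so the squared Frobenius norm is the trace. At \<open>k = 0\<close> this
  forces \<open>Q\<close> to vanish.\<close>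

lemma proj_mat_sq_sum:
  assumes "proj_mat r k Q"
  shows "(\<Sum>a<r. \<Sum>b<r. Q a b * Q a b) = real k"
proof -
  have "(\<Sum>b<r. Q a b * Q a b) = Q a a" if "a < r" for a
  proof -
    have "(\<Sum>b<r. Q a b * Q a b) = (\<Sum>b<r. Q a b * Q b a)"
      by (rule sum.cong) (use that proj_matD(1)[OF assms] in auto)
    then show ?thesis using proj_matD(2)[OF assms that that] by simp
  qed
  then show ?thesis using proj_matD(3)[OF assms] by simp
qed

lemma proj_mat_idem_vec:
  assumes "proj_mat r k Q" "a < r"
  shows "(\<Sum>b<r. Q a b * (\<Sum>c<r. Q b c * x c)) = (\<Sum>c<r. Q a c * x c)"
proof -
  have "(\<Sum>b<r. Q a b * (\<Sum>c<r. Q b c * x c)) = (\<Sum>c<r. \<Sum>b<r. Q a b * Q b c * x c)"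
    unfolding sum_distrib_left by (subst sum.swap) (simp add: mult_ac)
  also have "\<dots> = (\<Sum>c<r. (\<Sum>b<r. Q a b * Q b c) * x c)"
    by (simp add: sum_distrib_right)
  also have "\<dots> = (\<Sum>c<r. Q a c * x c)"
    by (intro sum.cong) (use assms(2) proj_matD(2)[OF assms(1)] in auto)
  finally show ?thesis .
qed

lemma proj_mat_self_adjoint:
  assumes "proj_mat r k Q"
  shows "(\<Sum>a<r. (\<Sum>b<r. Q a b * x b) * z a) = (\<Sum>b<r. x b * (\<Sum>a<r. Q b a * z a))"
proof -
  have "(\<Sum>a<r. (\<Sum>b<r. Q a b * x b) * z a) = (\<Sum>b<r. \<Sum>a<r. Q a b * x b * z a)"
    unfolding sum_distrib_right by (rule sum.swap)
  also have "\<dots> = (\<Sum>b<r. \<Sum>a<r. x b * (Q b a * z a))"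
    by (intro sum.cong) (use proj_matD(1)[OF assms] in \<open>auto simp: mult_ac\<close>)
  finally show ?thesis by (simp add: sum_distrib_left)
qed

text \<open>With \<open>y = Q x\<close>, self-adjointness and idempotence give <y, y> = <x, y>, so
  |x|^2 - |y|^2 = |x - y|^2.\<close>

lemma proj_mat_norm_le:
  assumes "proj_mat r k Q"
  shows "(\<Sum>a<r. (\<Sum>b<r. Q a b * x b)\<^sup>2) \<le> (\<Sum>a<r. (x a)\<^sup>2)"
proof -
  define y where "y = (\<lambda>a. \<Sum>b<r. Q a b * x b)"
  have yy: "(\<Sum>a<r. y a * y a) = (\<Sum>a<r. x a * y a)"
    using proj_mat_self_adjoint[OF assms, of x y] proj_mat_idem_vec[OF assms, of _ x]
    unfolding y_def by (auto intro!: sum.cong)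
  have "0 \<le> (\<Sum>a<r. (x a - y a)\<^sup>2)" by (intro sum_nonneg) auto
  also have "\<dots> = (\<Sum>a<r. (x a)\<^sup>2) - 2 * (\<Sum>a<r. x a * y a) + (\<Sum>a<r. y a * y a)"
    by (simp add: power2_eq_square algebra_simps sum.distrib sum_subtractf sum_distrib_left)
  finally show ?thesis using yy by (simp add: y_def power2_eq_square)
qed

text \<open>As \<open>y\<close> lies in the range of \<open>Q\<close>, the matrix
  \<open>y a * y b / \<alpha>\<close> is the projection onto a line inside that range. Removing it
  lowers the trace by one; positivity of \<open>k\<close> makes the natural subtraction
  \<open>k - 1\<close> genuine.\<close>

lemma proj_mat_remove:
  assumes Q: "proj_mat r k Q" and y: "\<And>a. y a = (\<Sum>b<r. Q a b * x b)"
    and nz: "\<exists>a<r. y a \<noteq> 0" and \<alpha>: "\<alpha> = (\<Sum>a<r. y a * y a)"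
  shows "0 < k" and "proj_mat r (k - 1) (\<lambda>a b. Q a b - y a * y b / \<alpha>)"
proof -
  obtain a0 where a0: "a0 < r" "y a0 \<noteq> 0" using nz by auto
  have "0 < y a0 * y a0" using a0 by (metis not_real_square_gt_zero)
  also have "\<dots> \<le> \<alpha>" unfolding \<alpha> by (rule member_le_sum) (use a0 in auto)
  finally have \<alpha>pos: "\<alpha> > 0" .
  show k: "0 < k"
  proof (rule ccontr)
    assume "\<not> 0 < k"
    then have "(\<Sum>a<r. \<Sum>b<r. Q a b * Q a b) = 0" using proj_mat_sq_sum[OF Q] by simp
    then have "\<forall>a<r. (\<Sum>b<r. Q a b * Q a b) = 0"
      by (subst (asm) sum_nonneg_eq_0_iff) (auto intro!: sum_nonneg)
    then have "\<forall>a<r. \<forall>b<r. Q a b = 0"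
      by (subst (asm) sum_nonneg_eq_0_iff) auto
    then have "y a0 = 0" unfolding y using a0 by simp
    with a0 show False by simp
  qed
  have Qy: "(\<Sum>c<r. Q a c * y c) = y a" if "a < r" for a
    using proj_mat_idem_vec[OF Q that, of x] by (simp add: y)
  have yQ: "(\<Sum>c<r. y c * Q c b) = y b" if "b < r" for b
  proof -
    have "(\<Sum>c<r. y c * Q c b) = (\<Sum>c<r. Q b c * y c)"
      by (intro sum.cong) (use that proj_matD(1)[OF Q] in auto)
    then show ?thesis using Qy that by simp
  qed
  \<comment> \<open>Of the four products, the two mixed ones each contribute minus
    \<open>y a * y b / \<alpha>\<close>, because \<open>Q\<close> fixes \<open>y\<close>; the last
    contributes it with a plus sign, because \<open>\<alpha>\<close> is the squared norm of
    \<open>y\<close>.\<close>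
  have idem: "(\<Sum>c<r. (Q a c - y a * y c / \<alpha>) * (Q c b - y c * y b / \<alpha>)) = Q a b - y a * y b / \<alpha>"
    if ab: "a < r" "b < r" for a b
  proof -
    have QQ: "(\<Sum>c<r. Q a c * Q c b) = Q a b" using proj_matD(2)[OF Q ab] .
    have "(\<Sum>c<r. (Q a c - y a * y c / \<alpha>) * (Q c b - y c * y b / \<alpha>)) =
      (\<Sum>c<r. Q a c * Q c b - (Q a c * y c) * (y b / \<alpha>) - (y a / \<alpha>) * (y c * Q c b)
          + (y a * y b / (\<alpha> * \<alpha>)) * (y c * y c))"
      by (rule sum.cong) (auto simp: algebra_simps)
    also have "\<dots> = (\<Sum>c<r. Q a c * Q c b) - (\<Sum>c<r. Q a c * y c) * (y b / \<alpha>)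
        - (y a / \<alpha>) * (\<Sum>c<r. y c * Q c b) + (y a * y b / (\<alpha> * \<alpha>)) * (\<Sum>c<r. y c * y c)"
      unfolding sum.distrib sum_subtractf sum_distrib_left sum_distrib_right ..
    also have "\<dots> = Q a b - y a * y b / \<alpha> - y a * y b / \<alpha> + (y a * y b / (\<alpha> * \<alpha>)) * \<alpha>"
      using QQ by (simp only: Qy[OF ab(1)] yQ[OF ab(2)] \<alpha>[symmetric]) (simp add: algebra_simps)
    also have "\<dots> = Q a b - y a * y b / \<alpha>" using \<alpha>pos by simp
    finally show ?thesis .
  qed
  have "(\<Sum>a<r. Q a a - y a * y a / \<alpha>) = real k - (\<Sum>a<r. y a * y a) / \<alpha>"
    by (simp add: proj_matD(3)[OF Q] sum_subtractf sum_divide_distrib)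
  also have "\<dots> = real (k - 1)" using \<alpha>pos k by (simp add: \<alpha>[symmetric] of_nat_diff)
  finally have "(\<Sum>a<r. Q a a - y a * y a / \<alpha>) = real (k - 1)" .
  then show "proj_mat r (k - 1) (\<lambda>a b. Q a b - y a * y b / \<alpha>)"
    unfolding proj_mat_def using idem proj_matD(1)[OF Q] by (simp add: mult.commute)
qed

text \<open>Self-adjointness makes a fixed vector of \<open>Q\<close> that is orthogonal to
  \<open>x\<close> orthogonal to \<open>y\<close> too, so the rank-one correction annihilates it.
  Witnesses against spanning thus survive the removal step.\<close>

lemma proj_mat_remove_fixed:
  assumes Q: "proj_mat r k Q" and y: "\<And>a. y a = (\<Sum>b<r. Q a b * x b)"
    and c: "\<And>a. a < r \<Longrightarrow> (\<Sum>b<r. Q a b * c b) = c a" and xc: "(\<Sum>b<r. x b * c b) = 0"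
    and a: "a < r"
  shows "(\<Sum>b<r. (Q a b - y a * y b / \<alpha>) * c b) = c a"
proof -
  have "(\<Sum>b<r. y b * c b) = (\<Sum>b<r. x b * c b)"
    using proj_mat_self_adjoint[OF Q, of x c] c by (simp add: y)
  then have yc: "(\<Sum>b<r. y b * c b) = 0" using xc by simp
  have "(\<Sum>b<r. (Q a b - y a * y b / \<alpha>) * c b) = (\<Sum>b<r. Q a b * c b) - (y a / \<alpha>) * (\<Sum>b<r. y b * c b)"
    unfolding sum_distrib_left sum_subtractf[symmetric] by (rule sum.cong) (auto simp: algebra_simps)
  then show ?thesis using yc c[OF a] by simp
qed

text \<open>Orthonormal columns mean that the matrices x_i x_i^T sum to the identity. Summing over
  \<open>i\<close> first leaves the squared Frobenius norm of \<open>Q\<close>.\<close>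

lemma proj_mat_tight_frame:
  fixes x :: "nat \<Rightarrow> nat \<Rightarrow> real"
  assumes Q: "proj_mat r k Q"
    and tight: "\<And>a b. a < r \<Longrightarrow> b < r \<Longrightarrow> (\<Sum>i<N. x i a * x i b) = (if a = b then 1 else 0)"
  shows "(\<Sum>i<N. \<Sum>a<r. (\<Sum>b<r. Q a b * x i b)\<^sup>2) = real k"
proof -
  have "(\<Sum>i<N. (\<Sum>b<r. Q a b * x i b)\<^sup>2) = (\<Sum>b<r. Q a b * Q a b)" for a
  proof -
    have "(\<Sum>i<N. (\<Sum>b<r. Q a b * x i b)\<^sup>2) = (\<Sum>i<N. \<Sum>b<r. \<Sum>c<r. Q a b * Q a c * (x i b * x i c))"
      by (simp add: power2_eq_square sum_product mult_ac)
    also have "\<dots> = (\<Sum>b<r. \<Sum>i<N. \<Sum>c<r. Q a b * Q a c * (x i b * x i c))"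
      by (rule sum.swap)
    also have "\<dots> = (\<Sum>b<r. \<Sum>c<r. \<Sum>i<N. Q a b * Q a c * (x i b * x i c))"
      by (intro sum.cong refl sum.swap)
    also have "\<dots> = (\<Sum>b<r. \<Sum>c<r. Q a b * Q a c * (if b = c then 1 else 0))"
      by (intro sum.cong refl) (simp add: sum_distrib_left[symmetric] tight)
    also have "\<dots> = (\<Sum>b<r. Q a b * Q a b)"
      by (intro sum.cong refl) (simp add: if_distrib cong: if_cong)
    finally show ?thesis .
  qed
  then show ?thesis
    by (subst sum.swap) (simp add: proj_mat_sq_sum[OF Q])
qed

section \<open>Independent samples as lists\<close>

lemma replicate_pmf_cons:
  "replicate_pmf (Suc n) p = map_pmf (\<lambda>(x, xs). x # xs) (pair_pmf p (replicate_pmf n p))"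
  by (simp add: pair_pmf_def map_pmf_def bind_assoc_pmf bind_return_pmf)

lemma pmf_replicate_pmf:
  "pmf (replicate_pmf n p) xs = (if length xs = n then prod_list (map (pmf p) xs) else 0)"
proof (induction n arbitrary: xs)
  case 0
  then show ?case by (cases xs) auto
next
  case (Suc n)
  show ?case
  proof (cases xs)
    case Nil
    have "[] \<notin> set_pmf (replicate_pmf (Suc n) p)" unfolding set_replicate_pmf by simp
    then show ?thesis using Nil by (simp add: pmf_eq_0_set_pmf del: replicate_pmf.simps)
  next
    case (Cons y ys)
    have "pmf (map_pmf (\<lambda>(x, xs). x # xs) (pair_pmf p (replicate_pmf n p))) ((\<lambda>(x, xs). x # xs) (y, ys))
        = pmf (pair_pmf p (replicate_pmf n p)) (y, ys)"
      by (rule pmf_map_inj') (auto simp: inj_def)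
    then have "pmf (replicate_pmf (Suc n) p) (y # ys) = pmf (pair_pmf p (replicate_pmf n p)) (y, ys)"
      by (simp only: replicate_pmf_cons prod.case)
    then show ?thesis using Cons Suc by (simp add: pmf_pair)
  qed
qed

lemma measure_bind_pmf:
  "measure_pmf.prob (bind_pmf p f) X = measure_pmf.expectation p (\<lambda>x. measure_pmf.prob (f x) X)"
proof -
  have int: "integrable (measure_pmf p) (\<lambda>x. measure_pmf.prob (f x) X)"
    by (rule measure_pmf.integrable_const_bound[where B = 1]) auto
  have "ennreal (measure_pmf.prob (bind_pmf p f) X) = (\<integral>\<^sup>+x. ennreal (measure_pmf.prob (f x) X) \<partial>measure_pmf p)"
    by (simp add: measure_pmf.emeasure_eq_measure[symmetric])
  also have "\<dots> = ennreal (measure_pmf.expectation p (\<lambda>x. measure_pmf.prob (f x) X))"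
    by (rule nn_integral_eq_integral[OF int]) simp
  finally show ?thesis
    by (subst (asm) ennreal_inj) (auto intro!: Bochner_Integration.integral_nonneg)
qed

text \<open>Both sides give every admissible list the weight \<open>1 / card A ^ n\<close>. This
  turns the uniform row lists of \<open>mcnus_space\<close> into independent draws.\<close>

lemma replicate_pmf_of_set:
  assumes "finite A" "A \<noteq> {}"
  shows "replicate_pmf n (pmf_of_set A) = pmf_of_set {xs. length xs = n \<and> set xs \<subseteq> A}"
proof (rule pmf_eqI)
  fix xs
  have eq: "{xs. set xs \<subseteq> A \<and> length xs = n} = {xs. length xs = n \<and> set xs \<subseteq> A}" by auto
  have fin: "finite {xs. length xs = n \<and> set xs \<subseteq> A}"
    using finite_lists_length_eq[OF assms(1), of n] unfolding eq .
  have card: "card {xs. length xs = n \<and> set xs \<subseteq> A} = card A ^ n"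
    using card_lists_length_eq[OF assms(1), of n] unfolding eq .
  obtain z where "z \<in> A" using assms by auto
  then have ne: "{xs. length xs = n \<and> set xs \<subseteq> A} \<noteq> {}"
    by (intro ex_in_conv[THEN iffD1] exI[of _ "replicate n z"]) (auto simp: set_replicate_conv_if)
  have "prod_list (map (pmf (pmf_of_set A)) xs) =
      (if set xs \<subseteq> A then 1 / real (card A) ^ length xs else 0)"
    by (induction xs) (use assms in \<open>auto simp: indicator_def field_simps\<close>)
  then show "pmf (replicate_pmf n (pmf_of_set A)) xs = pmf (pmf_of_set {xs. length xs = n \<and> set xs \<subseteq> A}) xs"
    using fin ne by (auto simp: pmf_replicate_pmf card indicator_def)
qed

text \<open>Inserting index \<open>n\<close> into \<open>Pi_pmf\<close> draws the new coordinate
  first, while the list needs it last; \<open>bind_commute_pmf\<close> swaps the two independent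
  draws.\<close>

lemma map_Pi_pmf_lessThan:
  "map_pmf (\<lambda>f. map f [0..<n]) (Pi_pmf {..<n} dflt (\<lambda>_. p)) = replicate_pmf n p"
proof (induction n)
  case 0
  show ?case by simp
next
  case (Suc n)
  have upd: "map (f(n := y)) [0..<Suc n] = map f [0..<n] @ [y]" for f :: "nat \<Rightarrow> 'a" and y
    by (auto intro!: map_cong)
  have "map_pmf (\<lambda>f. map f [0..<Suc n]) (Pi_pmf {..<Suc n} dflt (\<lambda>_. p))
      = do {y \<leftarrow> p; f \<leftarrow> Pi_pmf {..<n} dflt (\<lambda>_. p); return_pmf (map f [0..<n] @ [y])}"
    unfolding lessThan_Suc
    by (subst Pi_pmf_insert') (auto simp: map_bind_pmf upd simp del: upt_Suc map_append)
  also have "\<dots> = do {xs \<leftarrow> map_pmf (\<lambda>f. map f [0..<n]) (Pi_pmf {..<n} dflt (\<lambda>_. p));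
                      y \<leftarrow> p; return_pmf (xs @ [y])}"
    unfolding bind_map_pmf by (rule bind_commute_pmf)
  also have "\<dots> = replicate_pmf (n + 1) p"
    unfolding Suc replicate_pmf_distrib replicate_pmf_1
    by (simp add: bind_map_pmf)
  finally show ?case by simp
qed

section \<open>Probability that random rows fail to span\<close>

text \<open>Spanning is expressed dually, so that the matrix rows and images of kernel vectors met
  later can serve as the witness \<open>c\<close> directly.\<close>

definition nonspanning :: "nat \<Rightarrow> (nat \<Rightarrow> nat \<Rightarrow> real) \<Rightarrow> nat set \<Rightarrow> bool" where
  "nonspanning r x I \<longleftrightarrow> (\<exists>c. (\<exists>a<r. c a \<noteq> 0) \<and> (\<forall>i\<in>I. (\<Sum>a<r. x i a * c a) = 0))"

text \<open>Rows annihilated by \<open>Q\<close> add nothing to the sum of |Q x_i|^2, which is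
  \<open>k\<close>, and every other row adds at most \<open>B\<close>. So at least
  \<open>k / B\<close> rows are hit, each of probability at least \<open>q\<close>.\<close>

lemma prob_hit_projection:
  fixes x :: "nat \<Rightarrow> nat \<Rightarrow> real"
  assumes pm: "\<And>i. i < N \<Longrightarrow> q \<le> pmf p i" "0 < q"
    and tight: "\<And>a b. a < r \<Longrightarrow> b < r \<Longrightarrow> (\<Sum>i<N. x i a * x i b) = (if a = b then 1 else 0)"
    and B: "\<And>i. i < N \<Longrightarrow> (\<Sum>a<r. (x i a)\<^sup>2) \<le> B" "0 < B"
    and Q: "proj_mat r k Q"
  shows "real k * q / B \<le> (\<Sum>i\<in>{i. i < N \<and> (\<exists>a<r. (\<Sum>b<r. Q a b * x i b) \<noteq> 0)}. pmf p i)"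
proof -
  define H where "H = {i. i < N \<and> (\<exists>a<r. (\<Sum>b<r. Q a b * x i b) \<noteq> 0)}"
  have sub: "H \<subseteq> {..<N}" unfolding H_def by auto
  have "real k = (\<Sum>i<N. \<Sum>a<r. (\<Sum>b<r. Q a b * x i b)\<^sup>2)"
    using proj_mat_tight_frame[OF Q tight] by simp
  also have "\<dots> = (\<Sum>i\<in>H. \<Sum>a<r. (\<Sum>b<r. Q a b * x i b)\<^sup>2)"
    by (rule sum.mono_neutral_right) (use sub in \<open>auto simp: H_def\<close>)
  also have "\<dots> \<le> (\<Sum>i\<in>H. B)"
  proof (rule sum_mono)
    fix i assume "i \<in> H"
    then have "i < N" using sub by auto
    then show "(\<Sum>a<r. (\<Sum>b<r. Q a b * x i b)\<^sup>2) \<le> B"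
      using proj_mat_norm_le[OF Q, of "x i"] B(1)[of i] by linarith
  qed
  finally have "real k * (q / B) \<le> (\<Sum>i\<in>H. B) * (q / B)"
    using pm B by (intro mult_right_mono) auto
  also have "\<dots> = (\<Sum>i\<in>H. q)" using B by simp
  also have "\<dots> \<le> (\<Sum>i\<in>H. pmf p i)" by (intro sum_mono pm) (use sub in auto)
  finally show ?thesis unfolding H_def by simp
qed

text \<open>The event says that the range of \<open>Q\<close> still contains a nonzero vector
  orthogonal to all samples. With \<open>Q\<close> and \<open>k\<close> general in the induction,
  the first draw may replace \<open>Q\<close> by a smaller projection, which folds the expected
  codimension and Markov's inequality into one recursion.\<close>

lemma prob_nonspanning_projection:
  fixes x :: "nat \<Rightarrow> nat \<Rightarrow> real"
  assumes supp: "set_pmf p = {..<N}" and pm: "\<And>i. i < N \<Longrightarrow> q \<le> pmf p i" "0 < q"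
    and tight: "\<And>a b. a < r \<Longrightarrow> b < r \<Longrightarrow> (\<Sum>i<N. x i a * x i b) = (if a = b then 1 else 0)"
    and B: "\<And>i. i < N \<Longrightarrow> (\<Sum>a<r. (x i a)\<^sup>2) \<le> B" "0 < B"
    and Q: "proj_mat r k Q"
  shows "measure_pmf.prob (replicate_pmf d p)
      {is. \<exists>c. (\<exists>a<r. c a \<noteq> 0) \<and> (\<forall>a<r. (\<Sum>b<r. Q a b * c b) = c a) \<and>
               (\<forall>i\<in>set is. (\<Sum>a<r. x i a * c a) = 0)} \<le> real k * exp (- q / B) ^ d"
  using Q
proof (induction d arbitrary: k Q)
  case 0
  \<comment> \<open>For \<open>k = 0\<close> the projection is zero and fixes no nonzero vector; for
    \<open>k > 0\<close> the bound is at least 1.\<close>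
  show ?case
  proof (cases k)
    case 0
    have "(\<Sum>a<r. \<Sum>b<r. Q a b * Q a b) = 0" using proj_mat_sq_sum[OF \<open>proj_mat r k Q\<close>] 0 by simp
    then have "\<forall>a<r. (\<Sum>b<r. Q a b * Q a b) = 0"
      by (subst (asm) sum_nonneg_eq_0_iff) (auto intro!: sum_nonneg)
    then have "\<forall>a<r. \<forall>b<r. Q a b = 0"
      by (subst (asm) sum_nonneg_eq_0_iff) auto
    then have empty: "{is. \<exists>c. (\<exists>a<r. c a \<noteq> 0) \<and> (\<forall>a<r. (\<Sum>b<r. Q a b * c b) = c a) \<and>
               (\<forall>i\<in>set is. (\<Sum>a<r. x i a * c a) = 0)} = {}" by auto
    show ?thesis unfolding empty by simp
  next
    case (Suc k')
    then have "1 \<le> real k * exp (- q / B) ^ 0" by simp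
    then show ?thesis using measure_pmf.prob_le_1 order_trans by blast
  qed
next
  case (Suc d)
  define E where "E = (\<lambda>Q. {is. \<exists>c. (\<exists>a<r. c a \<noteq> 0) \<and> (\<forall>a<r. (\<Sum>b<r. Q a b * c b) = c a) \<and>
               (\<forall>i\<in>set is. (\<Sum>a<r. x i a * c a) = 0)})"
  define H where "H = {i. i < N \<and> (\<exists>a<r. (\<Sum>b<r. Q a b * x i b) \<noteq> 0)}"
  define e where "e = exp (- q / B)"
  have e: "0 < e" "1 - q / B \<le> e" unfolding e_def using exp_ge_add_one_self[of "- q / B"] by auto
  have sum1: "(\<Sum>i<N. pmf p i) = 1" by (rule sum_pmf_eq_1) (use supp in auto)
  \<comment> \<open>A draw in \<open>H\<close> has nonzero projection and reduces to rank
    \<open>k - 1\<close>, saving one \<open>e ^ d\<close>; any other draw keeps \<open>Q\<close> and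
    merely drops a constraint.\<close>
  have step: "measure_pmf.prob (map_pmf ((#) i) (replicate_pmf d p)) (E Q)
      \<le> real k * e ^ d - (if i \<in> H then e ^ d else 0)" if i: "i < N" for i
  proof (cases "i \<in> H")
    case False
    have "measure_pmf.prob (map_pmf ((#) i) (replicate_pmf d p)) (E Q)
        \<le> measure_pmf.prob (replicate_pmf d p) (E Q)"
      unfolding measure_map_pmf by (rule measure_pmf.finite_measure_mono) (auto simp: E_def)
    then show ?thesis using Suc.IH[OF Suc.prems] False unfolding E_def e_def by simp
  next
    case True
    define y where "y = (\<lambda>a. \<Sum>b<r. Q a b * x i b)"
    define \<alpha> where "\<alpha> = (\<Sum>a<r. y a * y a)"
    have nz: "\<exists>a<r. y a \<noteq> 0" using True unfolding H_def y_def by auto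
    have yeq: "y a = (\<Sum>b<r. Q a b * x i b)" for a unfolding y_def ..
    note rem = proj_mat_remove[OF Suc.prems yeq nz \<alpha>_def]
    have "measure_pmf.prob (map_pmf ((#) i) (replicate_pmf d p)) (E Q)
        \<le> measure_pmf.prob (replicate_pmf d p) (E (\<lambda>a b. Q a b - y a * y b / \<alpha>))"
      unfolding measure_map_pmf
    proof (rule measure_pmf.finite_measure_mono)
      show "(#) i -` E Q \<subseteq> E (\<lambda>a b. Q a b - y a * y b / \<alpha>)"
      proof
        fix js assume "js \<in> (#) i -` E Q"
        then obtain c where c: "\<exists>a<r. c a \<noteq> 0" "\<And>a. a < r \<Longrightarrow> (\<Sum>b<r. Q a b * c b) = c a"
          "\<forall>j\<in>set js. (\<Sum>a<r. x j a * c a) = 0" "(\<Sum>a<r. x i a * c a) = 0"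
          unfolding E_def by auto
        have "\<forall>a<r. (\<Sum>b<r. (Q a b - y a * y b / \<alpha>) * c b) = c a"
          using proj_mat_remove_fixed[OF Suc.prems yeq c(2) c(4)] by blast
        then show "js \<in> E (\<lambda>a b. Q a b - y a * y b / \<alpha>)" using c unfolding E_def by blast
      qed
    qed auto
    also have "\<dots> \<le> real (k - 1) * e ^ d"
      using Suc.IH[OF rem(2)] unfolding E_def e_def .
    also have "\<dots> = real k * e ^ d - e ^ d" using rem(1) by (simp add: of_nat_diff algebra_simps)
    finally show ?thesis using True by simp
  qed
  \<comment> \<open>Averaging over the first draw leaves \<open>e ^ d\<close> times the difference
    of \<open>k\<close> and the mass of \<open>H\<close>. That mass is at least
    \<open>k * q / B\<close>, which yields the new factor \<open>1 - q / B\<close>, at most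
    \<open>e\<close>.\<close>
  have "measure_pmf.prob (replicate_pmf (Suc d) p) (E Q)
      = measure_pmf.expectation p (\<lambda>i. measure_pmf.prob (map_pmf ((#) i) (replicate_pmf d p)) (E Q))"
    by (simp only: replicate_pmf.simps measure_bind_pmf map_pmf_def)
  also have "\<dots> = (\<Sum>i<N. measure_pmf.prob (map_pmf ((#) i) (replicate_pmf d p)) (E Q) * pmf p i)"
    by (rule integral_measure_pmf_real) (use supp in auto)
  also have "\<dots> \<le> (\<Sum>i<N. (real k * e ^ d - (if i \<in> H then e ^ d else 0)) * pmf p i)"
    by (intro sum_mono mult_right_mono step) auto
  also have "\<dots> = (\<Sum>i<N. real k * e ^ d * pmf p i) - (\<Sum>i<N. if i \<in> H then e ^ d * pmf p i else 0)"
    unfolding sum_subtractf[symmetric] by (rule sum.cong) (auto simp: algebra_simps)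
  also have "(\<Sum>i<N. if i \<in> H then e ^ d * pmf p i else 0) = (\<Sum>i\<in>H. e ^ d * pmf p i)"
    by (rule sum.mono_neutral_cong_right) (auto simp: H_def)
  also have "(\<Sum>i<N. real k * e ^ d * pmf p i) - (\<Sum>i\<in>H. e ^ d * pmf p i)
      = e ^ d * (real k - (\<Sum>i\<in>H. pmf p i))"
    by (simp add: sum_distrib_left[symmetric] sum1 algebra_simps)
  also have "\<dots> \<le> e ^ d * (real k - real k * q / B)"
    using prob_hit_projection[OF pm tight B Suc.prems] e(1)
    unfolding H_def by (intro mult_left_mono) auto
  also have "\<dots> = real k * e ^ d * (1 - q / B)" by (simp add: algebra_simps)
  also have "\<dots> \<le> real k * e ^ d * e" using e by (intro mult_left_mono) auto
  finally show ?case unfolding E_def e_def by (simp add: mult_ac)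
qed

text \<open>The recursion starts from the identity matrix, which fixes every vector and has trace
  \<open>r\<close>.\<close>

lemma prob_nonspanning:
  fixes x :: "nat \<Rightarrow> nat \<Rightarrow> real"
  assumes "set_pmf p = {..<N}" and "\<And>i. i < N \<Longrightarrow> q \<le> pmf p i" "0 < q"
    and "\<And>a b. a < r \<Longrightarrow> b < r \<Longrightarrow> (\<Sum>i<N. x i a * x i b) = (if a = b then 1 else 0)"
    and "\<And>i. i < N \<Longrightarrow> (\<Sum>a<r. (x i a)\<^sup>2) \<le> B" "0 < B"
  shows "measure_pmf.prob (replicate_pmf d p) {is. nonspanning r x (set is)}
      \<le> real r * exp (- (real d * q / B))"
proof -
  define Q :: "nat \<Rightarrow> nat \<Rightarrow> real" where "Q = (\<lambda>a b. if a = b then 1 else 0)"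
  have Qc: "(\<Sum>b<r. Q a b * c b) = c a" if "a < r" for a and c :: "nat \<Rightarrow> real"
    using that by (simp add: Q_def if_distrib[of "\<lambda>z. z * _"] cong: if_cong)
  have "proj_mat r r Q" unfolding proj_mat_def using Qc by (auto simp: Q_def)
  from prob_nonspanning_projection[OF assms this, of d] show ?thesis
    by (simp add: nonspanning_def Qc exp_of_nat_mult[symmetric] cong: conj_cong)
qed

section \<open>Rank and thin singular value decomposition\<close>

text \<open>The column space of the product lies in that of \<open>X\<close>. Dimensions are
  compared inside the span of the columns of \<open>X\<close>, taken as a vector space of its
  own.\<close>

lemma (in vec_space) rank_mult_le_left:
  assumes X: "X \<in> carrier_mat n t" and Y: "Y \<in> carrier_mat t nc"
  shows "rank (X * Y) \<le> rank X"
proof -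
  have XY: "X * Y \<in> carrier_mat n nc" using X Y by simp
  have colsX: "set (cols X) \<subseteq> carrier V" and colsXY: "set (cols (X * Y)) \<subseteq> carrier V"
    using cols_dim[of X] cols_dim[of "X * Y"] X by auto
  have sub: "span (set (cols (X * Y))) \<subseteq> span (set (cols X))"
  proof
    fix y assume "y \<in> span (set (cols (X * Y)))"
    then obtain z where z: "z \<in> carrier_vec nc" "y = X * Y *\<^sub>v z"
      using col_space_eq[OF XY] Y unfolding col_space_def by auto
    then have "y = X *\<^sub>v (Y *\<^sub>v z)" using X Y by simp
    moreover have "Y *\<^sub>v z \<in> carrier_vec t" using Y z by simp
    ultimately show "y \<in> span (set (cols X))"
      using col_space_eq[OF X] X unfolding col_space_def by auto
  qed
  have s1: "VectorSpace.subspace class_ring (span (set (cols X))) V"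
    and s2: "VectorSpace.subspace class_ring (span (set (cols (X * Y)))) V"
    using span_is_subspace colsX colsXY by auto
  interpret vX: vectorspace class_ring "vs (span (set (cols X)))"
    by (rule subspace_is_vs[OF s1])
  have "vectorspace.dim class_ring (vX.vs (span (set (cols (X * Y))))) \<le> vX.dim"
  proof (rule vX.subspace_dim)
    show "VectorSpace.subspace class_ring (span (set (cols (X * Y)))) (vs (span (set (cols X))))"
      by (rule nested_subspaces[OF s1 s2 sub])
    show "vX.fin_dim" by (rule fin_dim_span) (use colsX in auto)
    have "vectorspace.fin_dim class_ring (vs (span (set (cols (X * Y)))))"
      by (rule fin_dim_span) (use colsXY in auto)
    then show "vectorspace.fin_dim class_ring (vX.vs (span (set (cols (X * Y)))))" by simp
  qed
  then show ?thesis unfolding rank_def by simp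
qed

lemma (in vec_space) rank_left_inverse:
  assumes X: "X \<in> carrier_mat n t" and L: "L \<in> carrier_mat t n" and LX: "L * X = 1\<^sub>m t"
  shows "rank X = t"
proof (rule lin_indpt_full_rank[OF X])
  \<comment> \<open>Linear independence speaks about the set of columns, so repeated columns have to
    be excluded separately.\<close>
  show dist: "distinct (cols X)"
    unfolding distinct_conv_nth
  proof (intro allI impI)
    fix i j assume ij: "i < length (cols X)" "j < length (cols X)" "i \<noteq> j"
    then have ij': "i < t" "j < t" using X by auto
    show "cols X ! i \<noteq> cols X ! j"
    proof
      assume "cols X ! i = cols X ! j"
      then have "L *\<^sub>v Matrix.col X i = L *\<^sub>v Matrix.col X j" using ij by simp
      then have "Matrix.col (L * X) i = Matrix.col (L * X) j"
        using ij' X L by (metis col_mult2)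
      then have "Matrix.col (1\<^sub>m t) i $ i = Matrix.col (1\<^sub>m t :: 'a mat) j $ i" unfolding LX by simp
      then show False using ij' ij(3) by simp
    qed
  qed
  show "lin_indpt (set (cols X))"
  proof
    assume "lin_dep (set (cols X))"
    then obtain v where v: "v \<in> carrier_vec t" "v \<noteq> 0\<^sub>v t" "X *\<^sub>v v = 0\<^sub>v n"
      using lin_depE[OF X _ dist] by blast
    have "v = L * X *\<^sub>v v" using v LX by simp
    also have "\<dots> = L *\<^sub>v (X *\<^sub>v v)" using L X v by simp
    also have "\<dots> = 0\<^sub>v t" unfolding v(3) using L by (intro eq_vecI) (auto simp: scalar_prod_def)
    finally show False using v by simp
  qed
qed

lemma mrank_mult_le_left:
  assumes "X \<in> carrier_mat k t" "Y \<in> carrier_mat t l"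
  shows "mrank (X * Y) \<le> mrank X"
  using vec_space.rank_mult_le_left[OF assms] assms unfolding mrank_def by simp

lemma mrank_left_inverse:
  assumes "X \<in> carrier_mat k t" "L \<in> carrier_mat t k" "L * X = 1\<^sub>m t"
  shows "mrank X = t"
  using vec_space.rank_left_inverse[OF assms] assms unfolding mrank_def by simp

section \<open>Leading columns and the thin singular value decomposition\<close>

lemma first_cols_carrier: "W \<in> carrier_mat k l \<Longrightarrow> first_cols t W \<in> carrier_mat k t"
  unfolding first_cols_def by auto

lemma first_cols_orthonormal:
  assumes W: "W \<in> carrier_mat k k" "transpose_mat W * W = 1\<^sub>m k" and t: "t \<le> k"
  shows "transpose_mat (first_cols t W) * first_cols t W = 1\<^sub>m t"
proof (rule eq_matI)
  fix i j assume "i < dim_row (1\<^sub>m t :: real mat)" "j < dim_col (1\<^sub>m t :: real mat)"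
  then have ij: "i < t" "j < t" by auto
  have "(transpose_mat (first_cols t W) * first_cols t W) $$ (i, j) = (\<Sum>a<k. W $$ (a, i) * W $$ (a, j))"
    using ij W by (simp add: first_cols_def scalar_prod_def atLeast0LessThan)
  also have "\<dots> = (transpose_mat W * W) $$ (i, j)"
    using ij W(1) t by (simp add: scalar_prod_def atLeast0LessThan)
  also have "\<dots> = (1\<^sub>m t :: real mat) $$ (i, j)" unfolding W(2) using ij t by simp
  finally show "(transpose_mat (first_cols t W) * first_cols t W) $$ (i, j) = (1\<^sub>m t :: real mat) $$ (i, j)" .
qed (use W in \<open>auto simp: first_cols_def\<close>)

text \<open>Serves for the positions of positive singular values: these values are sorted, so the
  positions form an initial segment.\<close>

lemma down_closed_nat_eq_lessThan:
  fixes T :: "nat set"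
  assumes "finite T" and "\<And>i j. i \<in> T \<Longrightarrow> j \<le> i \<Longrightarrow> j \<in> T"
  shows "T = {..<card T}"
proof (cases "T = {}")
  case False
  then have "T = {..Max T}" using assms(2)[OF Max_in[OF assms(1)]] Max_ge[OF assms(1)] by blast
  then have "card T = Suc (Max T)" using card_atMost by metis
  then show ?thesis using \<open>T = {..Max T}\<close> lessThan_Suc_atMost by metis
qed simp

text \<open>\<open>D\<close> is the diagonal block of the positive singular values and
  \<open>D'\<close> its inverse. Their number \<open>u\<close> is the rank: \<open>A\<close> factors
  through \<open>first_cols u W\<close>, which conversely is a right multiple of
  \<open>A\<close>.\<close>

lemma svd_thin:
  assumes svd: "is_svd A W S Z" and A: "A \<in> carrier_mat k l" and t: "t = mrank A"
  obtains D D' where "D \<in> carrier_mat t t" "D' \<in> carrier_mat t t"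
    "D * D' = 1\<^sub>m t" "A = first_cols t W * D * transpose_mat (first_cols t Z)"
    "t \<le> k" "t \<le> l"
proof -
  have W: "W \<in> carrier_mat k k" "transpose_mat W * W = 1\<^sub>m k"
    and Z: "Z \<in> carrier_mat l l" "transpose_mat Z * Z = 1\<^sub>m l"
    and S: "S \<in> carrier_mat k l"
    and S0: "\<And>i j. i < k \<Longrightarrow> j < l \<Longrightarrow> i \<noteq> j \<Longrightarrow> S $$ (i, j) = 0"
    and Snn: "\<And>i. i < min k l \<Longrightarrow> S $$ (i, i) \<ge> 0"
    and Smono: "\<And>i j. i \<le> j \<Longrightarrow> j < min k l \<Longrightarrow> S $$ (j, j) \<le> S $$ (i, i)"
    and AWSZ: "A = W * S * transpose_mat Z"
    using svd A unfolding is_svd_def Let_def by auto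
  define T where "T = {i. i < min k l \<and> S $$ (i, i) > 0}"
  define u where "u = card T"
  have finT: "finite T" by (rule finite_subset[of _ "{..<min k l}"]) (auto simp: T_def)
  have Tu: "T = {..<u}" unfolding u_def
  proof (rule down_closed_nat_eq_lessThan[OF finT])
    fix i j assume "i \<in> T" "j \<le> i"
    then show "j \<in> T" using Smono[of j i] unfolding T_def by auto
  qed
  have Tmem: "b < min k l \<and> S $$ (b, b) > 0 \<longleftrightarrow> b < u" for b
    using arg_cong[OF Tu, of "\<lambda>X. b \<in> X"] unfolding T_def by simp
  \<comment> \<open>Otherwise \<open>min k l\<close> itself would be an index below
    \<open>u\<close>, against \<open>Tmem\<close>.\<close>
  have "u \<le> min k l"
    using Tmem[of "min k l"] by (meson less_irrefl not_le)
  then have uk: "u \<le> k" and ul: "u \<le> l" by auto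
  have Spos: "S $$ (b, b) > 0" if "b < u" for b using that Tmem by blast
  have Szero: "S $$ (b, b) = 0" if "\<not> b < u" "b < k" "b < l" for b
    using that Snn[of b] Tmem[of b] by auto
  define D where "D = Matrix.mat u u (\<lambda>(a, b). if a = b then S $$ (a, a) else 0)"
  define D' where "D' = Matrix.mat u u (\<lambda>(a, b). if a = b then 1 / S $$ (a, a) else 0)"
  have D: "D \<in> carrier_mat u u" and D': "D' \<in> carrier_mat u u" unfolding D_def D'_def by auto
  have DD': "D * D' = 1\<^sub>m u"
  proof (rule eq_matI)
    fix i j assume "i < dim_row (1\<^sub>m u :: real mat)" "j < dim_col (1\<^sub>m u :: real mat)"
    then have ij: "i < u" "j < u" by auto
    have "(D * D') $$ (i, j) = (\<Sum>b<u. (if i = b then S $$ (i, i) else 0) * (if b = j then 1 / S $$ (b, b) else 0))"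
      using ij by (simp add: D_def D'_def scalar_prod_def atLeast0LessThan)
    also have "\<dots> = (\<Sum>b<u. if i = b then (if i = j then 1 else 0) else 0)"
    proof (rule sum.cong)
      fix b assume "b \<in> {..<u}"
      then have "S $$ (b, b) \<noteq> 0" using Spos[of b] by simp
      then show "(if i = b then S $$ (i, i) else 0) * (if b = j then 1 / S $$ (b, b) else 0)
          = (if i = b then (if i = j then 1 else 0) else 0)" by auto
    qed simp
    also have "\<dots> = (1\<^sub>m u :: real mat) $$ (i, j)" using ij by simp
    finally show "(D * D') $$ (i, j) = (1\<^sub>m u :: real mat) $$ (i, j)" .
  qed (auto simp: D_def D'_def)
  let ?W = "first_cols u W" and ?Z = "first_cols u Z"
  have cW: "?W \<in> carrier_mat k u" and cZ: "?Z \<in> carrier_mat l u"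
    using W Z by (auto intro: first_cols_carrier)
  have WS: "(W * S) $$ (i, b) = (if b < u then W $$ (i, b) * S $$ (b, b) else 0)" if "i < k" "b < l" for i b
  proof -
    have "(W * S) $$ (i, b) = (\<Sum>a<k. W $$ (i, a) * S $$ (a, b))"
      using that W S by (simp add: scalar_prod_def atLeast0LessThan)
    also have "\<dots> = (\<Sum>a<k. if a = b then W $$ (i, b) * S $$ (b, b) else 0)"
      by (rule sum.cong) (use S0 that in auto)
    also have "\<dots> = (if b < k then W $$ (i, b) * S $$ (b, b) else 0)" by simp
    also have "\<dots> = (if b < u then W $$ (i, b) * S $$ (b, b) else 0)"
      using uk Szero that by auto
    finally show ?thesis .
  qed
  have WD: "(?W * D) $$ (i, b) = W $$ (i, b) * S $$ (b, b)" if "i < k" "b < u" for i b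
  proof -
    have "(?W * D) $$ (i, b) = (\<Sum>a<u. W $$ (i, a) * (if a = b then S $$ (a, a) else 0))"
      using that W by (simp add: D_def first_cols_def scalar_prod_def atLeast0LessThan)
    also have "\<dots> = (\<Sum>a<u. if a = b then W $$ (i, b) * S $$ (b, b) else 0)"
      by (rule sum.cong) auto
    finally show ?thesis using that by simp
  qed
  have Aeq: "A = ?W * D * transpose_mat ?Z"
  proof (rule eq_matI)
    fix i j assume "i < dim_row (?W * D * transpose_mat ?Z)" "j < dim_col (?W * D * transpose_mat ?Z)"
    then have ij: "i < k" "j < l" using cW cZ by auto
    have "A $$ (i, j) = (\<Sum>b<l. (W * S) $$ (i, b) * Z $$ (j, b))"
      unfolding AWSZ using ij W S Z(1)
      by (subst index_mult_mat(1)) (auto simp: scalar_prod_def atLeast0LessThan intro!: sum.cong)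
    also have "\<dots> = (\<Sum>b<l. if b < u then W $$ (i, b) * S $$ (b, b) * Z $$ (j, b) else 0)"
      by (rule sum.cong) (use WS ij in auto)
    also have "\<dots> = (\<Sum>b<u. W $$ (i, b) * S $$ (b, b) * Z $$ (j, b))"
      by (rule sum.mono_neutral_cong_right) (use ul in auto)
    also have "\<dots> = (\<Sum>b<u. (?W * D) $$ (i, b) * ?Z $$ (j, b))"
      by (rule sum.cong) (use WD ij Z(1) in \<open>auto simp: first_cols_def\<close>)
    also have "\<dots> = (?W * D * transpose_mat ?Z) $$ (i, j)"
      using ij cW cZ D
      by (subst index_mult_mat(1)) (auto simp: scalar_prod_def atLeast0LessThan intro!: sum.cong)
    finally show "A $$ (i, j) = (?W * D * transpose_mat ?Z) $$ (i, j)" .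
  qed (use A cW cZ in auto)
  have WtW: "transpose_mat ?W * ?W = 1\<^sub>m u" and ZtZ: "transpose_mat ?Z * ?Z = 1\<^sub>m u"
    using first_cols_orthonormal W Z uk ul by auto
  have rW: "mrank ?W = u" by (rule mrank_left_inverse[OF cW _ WtW]) (use cW in simp)
  have "A = ?W * (D * transpose_mat ?Z)" using Aeq cW D cZ by (simp add: assoc_mult_mat[of _ k u _ u _ l])
  then have le: "mrank A \<le> u" using mrank_mult_le_left[OF cW, of "D * transpose_mat ?Z" l] D cZ rW by simp
  \<comment> \<open>Cancelling \<open>?Z\<close> and \<open>D\<close> on the right recovers
    \<open>?W\<close>, of rank \<open>u\<close>, so the rank of \<open>A\<close> is at least
    \<open>u\<close>.\<close>
  have "A * (?Z * D') = ?W * D * (transpose_mat ?Z * (?Z * D'))"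
    unfolding Aeq by (rule assoc_mult_mat) (use cW D cZ D' in auto)
  also have "transpose_mat ?Z * (?Z * D') = transpose_mat ?Z * ?Z * D'"
    by (rule assoc_mult_mat[symmetric]) (use cZ D' in auto)
  also have "\<dots> = D'" using ZtZ D' by simp
  also have "?W * D * D' = ?W * (D * D')" by (rule assoc_mult_mat) (use cW D D' in auto)
  also have "\<dots> = ?W" using DD' cW by simp
  finally have "A * (?Z * D') = ?W" .
  moreover have "mrank (A * (?Z * D')) \<le> mrank A"
    by (rule mrank_mult_le_left[OF A]) (use cZ D' in auto)
  ultimately have "t = u" using le rW t by simp
  then show thesis using that D D' DD' Aeq uk ul by blast
qed

section \<open>Exact recovery from spanning samples\<close>

lemma svd_thin_of_mrank:
  assumes svd: "is_svd A W S Z" and A: "A \<in> carrier_mat k l" and t: "t = mrank A"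
  obtains D D' where "D \<in> carrier_mat t t" "D' \<in> carrier_mat t t" "D * D' = 1\<^sub>m t"
    "A = first_cols t W * D * transpose_mat (first_cols t Z)"
    "first_cols t W \<in> carrier_mat k t" "first_cols t Z \<in> carrier_mat l t"
    "transpose_mat (first_cols t W) * first_cols t W = 1\<^sub>m t"
    "transpose_mat (first_cols t Z) * first_cols t Z = 1\<^sub>m t"
proof -
  have W: "W \<in> carrier_mat k k" "transpose_mat W * W = 1\<^sub>m k"
    and Z: "Z \<in> carrier_mat l l" "transpose_mat Z * Z = 1\<^sub>m l"
    using svd A unfolding is_svd_def Let_def by auto
  from svd_thin[OF svd A t] obtain D D' where "D \<in> carrier_mat t t" "D' \<in> carrier_mat t t"
    "D * D' = 1\<^sub>m t" "A = first_cols t W * D * transpose_mat (first_cols t Z)" "t \<le> k" "t \<le> l" .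
  then show thesis using that first_cols_orthonormal W Z first_cols_carrier by metis
qed

lemma minus_mat_eq_zero:
  fixes A B :: "'a :: group_add mat"
  assumes "A \<in> carrier_mat m n" "B \<in> carrier_mat m n" and diff: "A - B = 0\<^sub>m m n"
  shows "A = B"
proof (rule eq_matI)
  fix i j assume "i < dim_row B" "j < dim_col B"
  then have ij: "i < m" "j < n" using assms by auto
  then have "(A - B) $$ (i, j) = 0" unfolding diff by simp
  then show "A $$ (i, j) = B $$ (i, j)" using ij assms(1,2) by simp
qed (use assms in auto)

section \<open>Column stage: recovering the column space of \<open>M\<close>\<close>

text \<open>The last factor is the sampling matrix with columns \<open>w j\<close> times the unit
  vector at \<open>idx j\<close>. Entry \<open>(i, j)\<close> of the product is \<open>w j\<close>
  times the inner product of row \<open>i\<close> of \<open>X\<close> and row \<open>idx j\<close>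
  of \<open>Z\<close>, so a nonzero row of \<open>X\<close> would witness
  \<open>nonspanning\<close>.\<close>

lemma mult_zero_of_spanning:
  assumes X: "X \<in> carrier_mat k r" and Z: "Z \<in> carrier_mat n r"
    and idx: "\<And>j. j < d \<Longrightarrow> idx j < n" and w: "\<And>j. j < d \<Longrightarrow> w j \<noteq> (0 :: real)"
    and span: "\<not> nonspanning r (\<lambda>i a. Z $$ (i, a)) (idx ` {..<d})"
    and zero: "X * (transpose_mat Z * Matrix.mat n d (\<lambda>(i, j). if i = idx j then w j else 0)) = 0\<^sub>m k d"
  shows "X = 0\<^sub>m k r"
proof (rule eq_matI)
  fix i b assume "i < dim_row (0\<^sub>m k r :: real mat)" "b < dim_col (0\<^sub>m k r :: real mat)"
  then have ib: "i < k" "b < r" by auto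
  let ?C = "Matrix.mat n d (\<lambda>(i, j). if i = idx j then w j else 0)"
  have ZC: "(transpose_mat Z * ?C) $$ (a, j) = Z $$ (idx j, a) * w j" if "a < r" "j < d" for a j
  proof -
    have "(transpose_mat Z * ?C) $$ (a, j) = (\<Sum>i<n. Z $$ (i, a) * (if i = idx j then w j else 0))"
      using that Z by (simp add: scalar_prod_def atLeast0LessThan)
    also have "\<dots> = (\<Sum>i<n. if i = idx j then Z $$ (idx j, a) * w j else 0)"
      by (rule sum.cong) auto
    finally show ?thesis using idx that by simp
  qed
  have "(\<Sum>a<r. Z $$ (idx j, a) * X $$ (i, a)) = 0" if j: "j < d" for j
  proof -
    have "0 = (X * (transpose_mat Z * ?C)) $$ (i, j)" unfolding zero using ib j by simp
    also have "\<dots> = (\<Sum>a<r. X $$ (i, a) * (transpose_mat Z * ?C) $$ (a, j))"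
      using ib j X Z by (subst index_mult_mat(1)) (auto simp: scalar_prod_def atLeast0LessThan intro!: sum.cong)
    also have "\<dots> = (\<Sum>a<r. (Z $$ (idx j, a) * X $$ (i, a)) * w j)"
      by (rule sum.cong) (use ZC j in auto)
    finally show ?thesis using w[OF j] by (simp add: sum_distrib_right[symmetric])
  qed
  then have orth: "\<forall>x\<in>idx ` {..<d}. (\<Sum>a<r. Z $$ (x, a) * X $$ (i, a)) = 0" by blast
  have "\<not> (\<exists>a<r. X $$ (i, a) \<noteq> 0)"
  proof
    assume "\<exists>a<r. X $$ (i, a) \<noteq> 0"
    then have "nonspanning r (\<lambda>i a. Z $$ (i, a)) (idx ` {..<d})"
      unfolding nonspanning_def using orth by (intro exI[of _ "\<lambda>a. X $$ (i, a)"] conjI)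
    with span show False by contradiction
  qed
  then show "X $$ (i, b) = (0\<^sub>m k r :: real mat) $$ (i, b)" using ib by auto
qed (use X in auto)

text \<open>The sample is a right multiple of \<open>M\<close>, and spanning rows of the right
  singular vectors keep its column space from shrinking. The factor \<open>Q\<close> is recorded so
  that conditions on rows of the fixed \<open>first_cols r W\<close> control the random
  \<open>U\<close>.\<close>

lemma top_left_sv_sample_mat:
  assumes M: "M \<in> carrier_mat m n" and svd: "is_svd M W S Z" and r: "mrank M = r"
    and idx: "\<And>j. j < d \<Longrightarrow> idx j < n" and P: "\<And>j. j < d \<Longrightarrow> pmf P (idx j) > 0"
    and span: "\<not> nonspanning r (\<lambda>i a. first_cols r Z $$ (i, a)) (idx ` {..<d})"
    and top: "top_left_sv (sample_mat M P d idx) (min r (mrank (sample_mat M P d idx))) U"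
  obtains t Q where "U \<in> carrier_mat m t" "Q \<in> carrier_mat r t" "transpose_mat U * U = 1\<^sub>m t"
    "M = U * (transpose_mat U * M)" "U = first_cols r W * Q"
proof -
  define A where "A = sample_mat M P d idx"
  define t where "t = mrank A"
  define w where "w = (\<lambda>j. 1 / sqrt (real d * pmf P (idx j)))"
  define C where "C = Matrix.mat n d (\<lambda>(i, j). if i = idx j then w j else 0)"
  have w: "w j \<noteq> 0" if "j < d" for j using P[OF that] that unfolding w_def by simp
  have C: "C \<in> carrier_mat n d" unfolding C_def by simp
  have A: "A \<in> carrier_mat m d" using M unfolding A_def sample_mat_def by simp
  have AMC: "A = M * C"
  proof (rule eq_matI)
    fix i j assume "i < dim_row (M * C)" "j < dim_col (M * C)"
    then have ij: "i < m" "j < d" using M C by auto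
    have "(M * C) $$ (i, j) = (\<Sum>a<n. M $$ (i, a) * (if a = idx j then w j else 0))"
      using ij M C by (simp add: C_def scalar_prod_def atLeast0LessThan)
    also have "\<dots> = (\<Sum>a<n. if a = idx j then M $$ (i, idx j) * w j else 0)"
      by (rule sum.cong) auto
    finally show "A $$ (i, j) = (M * C) $$ (i, j)"
      using idx ij M by (simp add: A_def sample_mat_def w_def)
  qed (use A M C in auto)
  \<comment> \<open>The minimum in the algorithm is therefore the rank of \<open>A\<close>, and
    \<open>U\<close> holds exactly the left singular vectors with positive singular value.\<close>
  have "t \<le> r" unfolding t_def AMC r[symmetric] by (rule mrank_mult_le_left[OF M C])
  then obtain W2 S2 Z2 where svd2: "is_svd A W2 S2 Z2" and U: "U = first_cols t W2"
    using top unfolding A_def[symmetric] t_def[symmetric] top_left_sv_def by (auto simp: min_absorb2)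
  let ?U = "first_cols r W" and ?V = "first_cols r Z" and ?Z2 = "first_cols t Z2"
  obtain D D' where D: "D \<in> carrier_mat r r" "D' \<in> carrier_mat r r" "D * D' = 1\<^sub>m r"
    and Meq: "M = ?U * D * transpose_mat ?V" and cU: "?U \<in> carrier_mat m r" and cV: "?V \<in> carrier_mat n r"
    using svd_thin_of_mrank[OF svd M r[symmetric]] by metis
  obtain E E' where E: "E \<in> carrier_mat t t" "E' \<in> carrier_mat t t" "E * E' = 1\<^sub>m t"
    and Aeq: "A = U * E * transpose_mat ?Z2" and U2: "U \<in> carrier_mat m t" and cZ2: "?Z2 \<in> carrier_mat d t"
    and UtU: "transpose_mat U * U = 1\<^sub>m t" and ZtZ: "transpose_mat ?Z2 * ?Z2 = 1\<^sub>m t"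
    using svd_thin_of_mrank[OF svd2 A t_def] unfolding U[symmetric] by metis
  have A2: "A = ?U * (D * (transpose_mat ?V * C))"
  proof -
    have "A = ?U * D * (transpose_mat ?V * C)"
      unfolding AMC Meq by (rule assoc_mult_mat) (use cU cV D C in auto)
    also have "\<dots> = ?U * (D * (transpose_mat ?V * C))"
      by (rule assoc_mult_mat) (use cU cV D C in auto)
    finally show ?thesis .
  qed
  have AU: "A * (?Z2 * E') = U"
  proof -
    have "A * (?Z2 * E') = U * E * (transpose_mat ?Z2 * (?Z2 * E'))"
      unfolding Aeq by (rule assoc_mult_mat) (use U2 E cZ2 in auto)
    also have "transpose_mat ?Z2 * (?Z2 * E') = transpose_mat ?Z2 * ?Z2 * E'"
      by (rule assoc_mult_mat[symmetric]) (use cZ2 E in auto)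
    also have "\<dots> = E'" using ZtZ E by simp
    also have "U * E * E' = U * (E * E')" by (rule assoc_mult_mat) (use U2 E in auto)
    also have "\<dots> = U" using E U2 by simp
    finally show ?thesis .
  qed
  define Q where "Q = D * (transpose_mat ?V * C) * (?Z2 * E')"
  have Q: "Q \<in> carrier_mat r t" unfolding Q_def using D cV C cZ2 E by auto
  have UQ: "U = ?U * Q"
  proof -
    have "U = ?U * (D * (transpose_mat ?V * C)) * (?Z2 * E')" using AU A2 by simp
    also have "\<dots> = ?U * Q"
      unfolding Q_def by (rule assoc_mult_mat) (use cU cV D C cZ2 E in auto)
    finally show ?thesis .
  qed
  \<comment> \<open>\<open>Y\<close> projects onto the orthogonal complement of the range of
    \<open>U\<close> and annihilates \<open>A\<close>. Spanning removes the factor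
    \<open>transpose_mat ?V * C\<close> and \<open>D'\<close> cancels \<open>D\<close>, so
    \<open>Y\<close> annihilates \<open>?U\<close> and with it \<open>M\<close>.\<close>
  define Y where "Y = 1\<^sub>m m - U * transpose_mat U"
  have Y: "Y \<in> carrier_mat m m" unfolding Y_def using U2 by auto
  have YU: "Y * U = 0\<^sub>m m t"
  proof -
    have "Y * U = 1\<^sub>m m * U - U * transpose_mat U * U"
      unfolding Y_def by (rule minus_mult_distrib_mat) (use U2 in auto)
    also have "U * transpose_mat U * U = U * (transpose_mat U * U)"
      by (rule assoc_mult_mat) (use U2 in auto)
    also have "\<dots> = U" using UtU U2 by simp
    finally show ?thesis using U2 by simp
  qed
  have YA: "Y * A = 0\<^sub>m m d"
  proof -
    have "A = U * (E * transpose_mat ?Z2)"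
      unfolding Aeq by (rule assoc_mult_mat) (use U2 E cZ2 in auto)
    then have "Y * A = Y * U * (E * transpose_mat ?Z2)"
      by (simp, intro assoc_mult_mat[symmetric]) (use Y U2 E cZ2 in auto)
    then show ?thesis unfolding YU using E cZ2 by simp
  qed
  have "Y * ?U * D * (transpose_mat ?V * C) = Y * ?U * (D * (transpose_mat ?V * C))"
    by (rule assoc_mult_mat) (use Y cU D cV C in auto)
  also have "\<dots> = Y * A"
    unfolding A2 by (rule assoc_mult_mat) (use Y cU D cV C in auto)
  finally have "Y * ?U * D * (transpose_mat ?V * C) = 0\<^sub>m m d" using YA by simp
  then have YUD: "Y * ?U * D = 0\<^sub>m m r"
    using mult_zero_of_spanning[of "Y * ?U * D" m r ?V n d idx w] Y cU D cV idx w span unfolding C_def by auto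
  have "Y * ?U = Y * ?U * (D * D')" using D Y cU by simp
  also have "\<dots> = Y * ?U * D * D'"
    by (rule assoc_mult_mat[symmetric]) (use Y cU D in auto)
  also have "\<dots> = 0\<^sub>m m r" unfolding YUD using D by simp
  finally have YU0: "Y * ?U = 0\<^sub>m m r" .
  have "M = ?U * (D * transpose_mat ?V)"
    unfolding Meq by (rule assoc_mult_mat) (use cU D cV in auto)
  then have "Y * M = Y * ?U * (D * transpose_mat ?V)"
    by (simp, intro assoc_mult_mat[symmetric]) (use Y cU D cV in auto)
  then have YM: "Y * M = 0\<^sub>m m n" unfolding YU0 using D cV by simp
  have "Y * M = 1\<^sub>m m * M - U * transpose_mat U * M"
    unfolding Y_def by (rule minus_mult_distrib_mat) (use U2 M in auto)
  also have "1\<^sub>m m * M = M" using M by simp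
  also have "U * transpose_mat U * M = U * (transpose_mat U * M)"
    by (rule assoc_mult_mat) (use U2 M in auto)
  finally have diff: "M - U * (transpose_mat U * M) = 0\<^sub>m m n" using YM by simp
  have UUM: "U * (transpose_mat U * M) \<in> carrier_mat m n" using U2 M by auto
  have "M = U * (transpose_mat U * M)" by (rule minus_mat_eq_zero[OF M UUM diff])
  then show thesis using that U2 Q UtU UQ by blast
qed

section \<open>Row stage: least squares on the sampled rows\<close>

text \<open>Column \<open>i\<close> of \<open>M\<close> is \<open>U\<close> times \<open>c\<close>,
  so the normal equations return \<open>c\<close> once \<open>G\<close> is invertible. A kernel
  vector \<open>v\<close> of \<open>G\<close> is killed by \<open>UO\<close>, which makes
  \<open>Q\<close> times \<open>v\<close> orthogonal to all sampled rows of \<open>U1\<close>;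
  spanning makes it zero, hence \<open>U\<close> kills \<open>v\<close>, and orthonormality gives
  \<open>v = 0\<close>.\<close>

lemma recon_ok_of_spanning:
  assumes M: "M \<in> carrier_mat m n" and U: "U \<in> carrier_mat m t" and UtU: "transpose_mat U * U = 1\<^sub>m t"
    and UUM: "M = U * (transpose_mat U * M)" and U1: "U1 \<in> carrier_mat m r"
    and Q: "Q \<in> carrier_mat r t" and UQ: "U = U1 * Q" and i: "i < n" and Ob: "set Ob \<subseteq> {..<m}"
    and span: "\<not> nonspanning r (\<lambda>o' a. U1 $$ (o', a)) (set Ob)"
  shows "recon_ok M U Ob i"
proof -
  define UO where "UO = rows_sel U Ob"
  define G where "G = transpose_mat UO * UO"
  define c where "c = transpose_mat U *\<^sub>v Matrix.col M i"
  let ?s = "length Ob"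
  have UO: "UO \<in> carrier_mat ?s t" unfolding UO_def rows_sel_def using U by simp
  have G: "G \<in> carrier_mat t t" unfolding G_def using UO by auto
  have c: "c \<in> carrier_vec t" unfolding c_def using U M by auto
  have colM: "Matrix.col M i \<in> carrier_vec m" using M by auto
  have sel: "vec_sel (U *\<^sub>v v) Ob = UO *\<^sub>v v" if v: "v \<in> carrier_vec t" for v
  proof (rule eq_vecI)
    fix a assume "a < dim_vec (UO *\<^sub>v v)"
    then have a: "a < ?s" using UO by simp
    then have "Ob ! a < m" using Ob nth_mem by fastforce
    then show "vec_sel (U *\<^sub>v v) Ob $ a = (UO *\<^sub>v v) $ a"
      using a U v by (simp add: vec_sel_def UO_def rows_sel_def scalar_prod_def)
  qed (use UO in \<open>simp add: vec_sel_def\<close>)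
  have colU: "Matrix.col M i = U *\<^sub>v c"
  proof -
    have "Matrix.col M i = Matrix.col (U * (transpose_mat U * M)) i" using UUM by simp
    also have "\<dots> = U *\<^sub>v Matrix.col (transpose_mat U * M) i"
      by (rule col_mult2) (use U M i in auto)
    also have "Matrix.col (transpose_mat U * M) i = c"
      unfolding c_def by (rule col_mult2) (use U M i in auto)
    finally show ?thesis .
  qed
  have inj: "v = 0\<^sub>v t" if v: "v \<in> carrier_vec t" and Gv: "G *\<^sub>v v = 0\<^sub>v t" for v
  proof -
    have "(UO *\<^sub>v v) \<bullet> (UO *\<^sub>v v) = v \<bullet> (transpose_mat UO *\<^sub>v (UO *\<^sub>v v))"
      using UO v by (metis comm_scalar_prod mult_mat_vec_carrier transpose_carrier_mat transpose_vec_mult_scalar)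
    also have "transpose_mat UO *\<^sub>v (UO *\<^sub>v v) = G *\<^sub>v v"
      unfolding G_def using UO v by simp
    also have "v \<bullet> (G *\<^sub>v v) = 0" unfolding Gv using v by simp
    finally have "(\<Sum>a<?s. (UO *\<^sub>v v) $ a * (UO *\<^sub>v v) $ a) = 0"
      using UO by (simp add: scalar_prod_def atLeast0LessThan)
    then have UOv: "(UO *\<^sub>v v) $ a = 0" if "a < ?s" for a
      using that by (subst (asm) sum_nonneg_eq_0_iff) auto
    have Qv: "Q *\<^sub>v v \<in> carrier_vec r" using Q v by auto
    have Uv: "U *\<^sub>v v = U1 *\<^sub>v (Q *\<^sub>v v)" unfolding UQ using U1 Q v by simp
    have "(\<Sum>b<r. U1 $$ (x, b) * (Q *\<^sub>v v) $ b) = 0" if "x \<in> set Ob" for x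
    proof -
      obtain a where a: "a < ?s" "x = Ob ! a" using \<open>x \<in> set Ob\<close> by (metis in_set_conv_nth)
      have x: "x < m" using that Ob by auto
      have "(\<Sum>b<r. U1 $$ (x, b) * (Q *\<^sub>v v) $ b) = (U1 *\<^sub>v (Q *\<^sub>v v)) $ x"
        using x U1 Qv Q by (auto simp: scalar_prod_def atLeast0LessThan intro!: sum.cong)
      also have "\<dots> = vec_sel (U *\<^sub>v v) Ob $ a" using a unfolding Uv vec_sel_def by simp
      also have "\<dots> = 0" unfolding sel[OF v] using UOv a by simp
      finally show ?thesis .
    qed
    then have orth: "\<forall>x\<in>set Ob. (\<Sum>b<r. U1 $$ (x, b) * (Q *\<^sub>v v) $ b) = 0" by blast
    have "\<not> (\<exists>b<r. (Q *\<^sub>v v) $ b \<noteq> 0)"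
    proof
      assume "\<exists>b<r. (Q *\<^sub>v v) $ b \<noteq> 0"
      then have "nonspanning r (\<lambda>i a. U1 $$ (i, a)) (set Ob)"
        unfolding nonspanning_def using orth by (intro exI[of _ "\<lambda>a. (Q *\<^sub>v v) $ a"] conjI)
      with span show False by contradiction
    qed
    then have "Q *\<^sub>v v = 0\<^sub>v r" using Qv Q by (intro eq_vecI) auto
    then have "U *\<^sub>v v = 0\<^sub>v m" unfolding Uv using U1 by (intro eq_vecI) (auto simp: scalar_prod_def)
    then have "transpose_mat U *\<^sub>v (U *\<^sub>v v) = 0\<^sub>v t"
      using U by (intro eq_vecI) (auto simp: scalar_prod_def)
    moreover have "transpose_mat U *\<^sub>v (U *\<^sub>v v) = transpose_mat U * U *\<^sub>v v"
      by (rule assoc_mult_mat_vec[symmetric]) (use U v in auto)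
    ultimately show ?thesis using UtU v by simp
  qed
  have "Determinant.det G \<noteq> 0" using inj unfolding det_0_iff_vec_prod_zero_field[OF G] by blast
  \<comment> \<open>The argument \<open>()\<close> fills the extension slot of the record
    \<open>ring_mat\<close>.\<close>
  from det_non_zero_imp_unit[OF G this, of "()"]
  obtain X where X: "X \<in> carrier_mat t t" "G * X = 1\<^sub>m t" "X * G = 1\<^sub>m t"
    unfolding Units_def ring_mat_def by auto
  have "vec_sel (Matrix.col M i) Ob = UO *\<^sub>v c" unfolding colU by (rule sel[OF c])
  then have "transpose_mat UO *\<^sub>v vec_sel (Matrix.col M i) Ob = G *\<^sub>v c"
    unfolding G_def using UO c by simp
  then have "U *\<^sub>v (X *\<^sub>v (transpose_mat UO *\<^sub>v vec_sel (Matrix.col M i) Ob)) = U *\<^sub>v (X * G *\<^sub>v c)"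
    by (simp only: assoc_mult_mat_vec[OF X(1) G c])
  also have "\<dots> = Matrix.col M i" unfolding X(3) colU using c by simp
  finally have "U *\<^sub>v (X *\<^sub>v (transpose_mat UO *\<^sub>v vec_sel (Matrix.col M i) Ob)) = Matrix.col M i" .
  then show ?thesis using X U
    unfolding recon_ok_def Let_def UO_def[symmetric] G_def[symmetric] by auto
qed

section \<open>Union bound\<close>

lemma orthonormal_cols_sum:
  assumes X: "X \<in> carrier_mat N r" "transpose_mat X * X = 1\<^sub>m r" and ab: "a < r" "b < r"
  shows "(\<Sum>i<N. X $$ (i, a) * X $$ (i, b)) = (if a = b then 1 else 0)"
proof -
  have "(\<Sum>i<N. X $$ (i, a) * X $$ (i, b)) = (transpose_mat X * X) $$ (a, b)"
    using X(1) ab by (simp add: scalar_prod_def atLeast0LessThan)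
  then show ?thesis unfolding X(2) using ab by simp
qed

text \<open>Column 0 exists because \<open>r\<close> is positive, and it has norm one, so some row
  is nonzero.\<close>

lemma row_bound_pos:
  fixes X :: "real mat"
  assumes X: "X \<in> carrier_mat N r" "transpose_mat X * X = 1\<^sub>m r" and r: "0 < r"
    and B: "\<And>i. i < N \<Longrightarrow> row_sqnorm X i \<le> B"
  shows "0 < B"
proof -
  have "(\<Sum>i<N. (X $$ (i, 0))\<^sup>2) = 1"
    using orthonormal_cols_sum[OF X r r] by (simp add: power2_eq_square)
  then obtain i where i: "i < N" "X $$ (i, 0) \<noteq> 0"
    by (metis (no_types, lifting) lessThan_iff power_zero_numeral sum.neutral zero_neq_one)
  have "0 < (X $$ (i, 0))\<^sup>2" using i by simp
  also have "\<dots> \<le> row_sqnorm X i"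
    unfolding row_sqnorm_def by (rule member_le_sum) (use X r in auto)
  finally show ?thesis using B[OF i(1)] by linarith
qed

text \<open>The sample size makes \<open>d * q / B\<close> at least \<open>7 * ln \<beta>\<close>,
  hence at least \<open>ln \<beta>\<close>, which is nonnegative; the exponential then becomes
  \<open>1 / \<beta>\<close>.\<close>

lemma prob_nonspanning_rows:
  fixes X :: "real mat"
  assumes X: "X \<in> carrier_mat N r" "transpose_mat X * X = 1\<^sub>m r" and r: "0 < r"
    and B: "\<And>i. i < N \<Longrightarrow> row_sqnorm X i \<le> B"
    and p: "set_pmf p = {..<N}" "\<And>i. i < N \<Longrightarrow> q \<le> pmf p i" "0 < q"
    and \<beta>: "1 \<le> \<beta>" and d: "7 * B * ln \<beta> / q \<le> real d"
  shows "measure_pmf.prob (replicate_pmf d p) {is. nonspanning r (\<lambda>i a. X $$ (i, a)) (set is)} \<le> real r / \<beta>"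
proof -
  have Bpos: "0 < B" by (rule row_bound_pos[OF X r B])
  have "(\<Sum>a<r. (X $$ (i, a))\<^sup>2) \<le> B" if "i < N" for i
    using B[OF that] X(1) unfolding row_sqnorm_def by simp
  from prob_nonspanning[OF p orthonormal_cols_sum[OF X] this Bpos, of d]
  have "measure_pmf.prob (replicate_pmf d p) {is. nonspanning r (\<lambda>i a. X $$ (i, a)) (set is)}
      \<le> real r * exp (- (real d * q / B))" by simp
  also have "\<dots> \<le> real r * exp (- ln \<beta>)"
  proof -
    have "0 \<le> ln \<beta>" using \<beta> by simp
    moreover have "7 * ln \<beta> \<le> real d * q / B" using d p(3) Bpos by (simp add: field_simps)
    ultimately have "ln \<beta> \<le> real d * q / B" by linarith
    then show ?thesis by (intro mult_left_mono) auto
  qed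
  also have "\<dots> = real r / \<beta>" using \<beta> by (simp add: exp_minus field_simps)
  finally show ?thesis .
qed

text \<open>These are the values of \<open>B\<close> in the two stages. Divided by the least column
  probability, respectively by \<open>1 / real m\<close>, they give the sample-size bounds; for
  entries the factor \<open>m\<close> cancels.\<close>

lemma incoherence_bounds:
  assumes M: "M \<in> carrier_mat m n" and r: "0 < r"
  shows "i < m \<Longrightarrow> row_sqnorm (first_cols r W) i \<le> incoherence M r W Z * real r / real m"
    and "i < n \<Longrightarrow> row_sqnorm (first_cols r Z) i \<le> incoherence M r W Z * real r / real n"
proof -
  assume i: "i < m"
  have "real m / real r * row_sqnorm (first_cols r W) i
      \<le> Max ((\<lambda>i. real m / real r * row_sqnorm (first_cols r W) i) ` {..<m})"
    by (rule Max_ge) (use i in auto)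
  also have "\<dots> \<le> incoherence M r W Z" using M unfolding incoherence_def by simp
  finally show "row_sqnorm (first_cols r W) i \<le> incoherence M r W Z * real r / real m"
    using i r by (simp add: field_simps)
next
  assume i: "i < n"
  have "real n / real r * row_sqnorm (first_cols r Z) i
      \<le> Max ((\<lambda>i. real n / real r * row_sqnorm (first_cols r Z) i) ` {..<n})"
    by (rule Max_ge) (use i in auto)
  also have "\<dots> \<le> incoherence M r W Z" using M unfolding incoherence_def by simp
  finally show "row_sqnorm (first_cols r Z) i \<le> incoherence M r W Z * real r / real n"
    using i r by (simp add: field_simps)
qed

section \<open>Support and marginals of the sampling space\<close>

text \<open>Success is argued on the support only. The assumption \<open>0 < m\<close> ensures that
  the set of row lists is nonempty, so that \<open>pmf_of_set\<close> is meaningful.\<close>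

lemma set_mcnus_space:
  assumes "(idx, Os) \<in> set_pmf (mcnus_space m n d s P)" and "0 < m"
  shows "j < d \<Longrightarrow> idx j \<in> set_pmf P" and "i < n \<Longrightarrow> set (Os i) \<subseteq> {..<m}"
proof -
  let ?L = "{Ob. length Ob = s \<and> set Ob \<subseteq> {..<m}}"
  have fin: "finite ?L"
    using finite_lists_length_eq[of "{..<m}" s] by (simp add: conj_commute)
  have ne: "?L \<noteq> {}"
    using assms(2) by (intro ex_in_conv[THEN iffD1] exI[of _ "replicate s 0"]) (auto simp: set_replicate_conv_if)
  show "j < d \<Longrightarrow> idx j \<in> set_pmf P" "i < n \<Longrightarrow> set (Os i) \<subseteq> {..<m}"
    using assms(1) set_pmf_of_set[OF ne fin]
    unfolding mcnus_space_def by (auto simp: set_Pi_pmf PiE_dflt_def)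
qed

lemma prob_mcnus_columns:
  "measure_pmf.prob (mcnus_space m n d s P) {(idx, Os). R (idx ` {..<d})}
    = measure_pmf.prob (replicate_pmf d P) {is. R (set is)}"
proof -
  have "map_pmf (\<lambda>f. map f [0..<d]) (map_pmf fst (mcnus_space m n d s P)) = replicate_pmf d P"
    unfolding mcnus_space_def map_fst_pair_pmf by (rule map_Pi_pmf_lessThan)
  then have "measure_pmf.prob (replicate_pmf d P) {is. R (set is)}
      = measure_pmf.prob (map_pmf (\<lambda>f. map f [0..<d]) (map_pmf fst (mcnus_space m n d s P))) {is. R (set is)}"
    by simp
  also have "\<dots> = measure_pmf.prob (mcnus_space m n d s P) {(idx, Os). R (idx ` {..<d})}"
    unfolding measure_map_pmf by (rule arg_cong[of _ _ "measure_pmf.prob _"]) (auto simp: atLeast0LessThan)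
  finally show ?thesis ..
qed

text \<open>Coordinate \<open>i\<close> of the product has the uniform distribution on row lists as
  its marginal, which is that of \<open>s\<close> independent draws.\<close>

lemma prob_mcnus_entries:
  assumes i: "i < n" and m: "0 < m"
  shows "measure_pmf.prob (mcnus_space m n d s P) {(idx, Os). R (Os i)}
    = measure_pmf.prob (replicate_pmf s (pmf_of_set {..<m})) {Ob. R Ob}"
proof -
  have ne: "{..<m} \<noteq> {}" using m by auto
  have "map_pmf (\<lambda>Os. Os i) (map_pmf snd (mcnus_space m n d s P)) = replicate_pmf s (pmf_of_set {..<m})"
    unfolding mcnus_space_def map_snd_pair_pmf replicate_pmf_of_set[OF finite_lessThan ne]
    using i by (subst Pi_pmf_component) auto
  then have "measure_pmf.prob (replicate_pmf s (pmf_of_set {..<m})) {Ob. R Ob}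
      = measure_pmf.prob (map_pmf (\<lambda>Os. Os i) (map_pmf snd (mcnus_space m n d s P))) {Ob. R Ob}"
    by simp
  also have "\<dots> = measure_pmf.prob (mcnus_space m n d s P) {(idx, Os). R (Os i)}"
    unfolding measure_map_pmf by (rule arg_cong[of _ _ "measure_pmf.prob _"]) auto
  finally show ?thesis ..
qed

section \<open>From spanning samples to the success probability\<close>

lemma mcnus_success_of_spanning:
  assumes M: "M \<in> carrier_mat m n" and svd: "is_svd M W S Z" and r: "mrank M = r"
    and P: "set_pmf P = {..<n}" and m: "0 < m"
    and supp: "(idx, Os) \<in> set_pmf (mcnus_space m n d s P)"
    and cols: "\<not> nonspanning r (\<lambda>i a. first_cols r Z $$ (i, a)) (idx ` {..<d})"
    and entries: "\<And>i. i < n \<Longrightarrow> \<not> nonspanning r (\<lambda>i a. first_cols r W $$ (i, a)) (set (Os i))"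
  shows "mcnus_success M r d P idx Os"
  unfolding mcnus_success_def Let_def
proof (intro allI impI)
  fix U i
  assume top: "top_left_sv (sample_mat M P d idx) (min r (mrank (sample_mat M P d idx))) U"
    and "i < dim_col M"
  then have i: "i < n" using M by simp
  have idx: "idx j < n" if "j < d" for j using set_mcnus_space(1)[OF supp m that] P by simp
  have pos: "pmf P (idx j) > 0" if "j < d" for j
    using set_mcnus_space(1)[OF supp m that] by (rule pmf_positive)
  obtain t Q where "U \<in> carrier_mat m t" "Q \<in> carrier_mat r t" "transpose_mat U * U = 1\<^sub>m t"
    "M = U * (transpose_mat U * M)" "U = first_cols r W * Q"
    using top_left_sv_sample_mat[OF M svd r idx pos cols top] .
  moreover have "first_cols r W \<in> carrier_mat m r"
    using svd M unfolding is_svd_def Let_def by (auto intro: first_cols_carrier)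
  ultimately show "recon_ok M U (Os i) i"
    using recon_ok_of_spanning[OF M] i set_mcnus_space(2)[OF supp m i] entries[OF i] by blast
qed

theorem theorem1:
  fixes M :: "real mat" and m n r d s :: nat and P :: "nat pmf" and \<delta> :: real
    and W S Z :: "real mat"
  assumes "M \<in> carrier_mat m n" and "m \<le> n"
    and "mrank M = r" and "r > 0"
    and "set_pmf P = {..<n}"
    and "0 < \<delta>" and "\<delta> < 1"
    and "is_svd M W S Z"
    and "d \<ge> r" and "s > 0"
    and "real d \<ge> 7 * incoherence M r W Z * real r * ln (2 * real r / \<delta>)
                    / (real n * Min (pmf P ` {..<n}))"
    and "real s \<ge> 7 * incoherence M r W Z * real r * ln (2 * real r * real n / \<delta>)"
  shows "measure_pmf.prob (mcnus_space m n d s P)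
           {(idx, Os). mcnus_success M r d P idx Os} \<ge> 1 - \<delta>"
proof -
  note M = assms(1) and r = assms(3,4) and P = assms(5) and \<delta> = assms(6,7) and svd = assms(8)
  let ?\<Omega> = "mcnus_space m n d s P" and ?U = "first_cols r W" and ?V = "first_cols r Z"
  let ?p = "Min (pmf P ` {..<n})" and ?\<mu> = "incoherence M r W Z"
  have W: "W \<in> carrier_mat m m" "transpose_mat W * W = 1\<^sub>m m"
    and Z: "Z \<in> carrier_mat n n" "transpose_mat Z * Z = 1\<^sub>m n"
    using svd M unfolding is_svd_def Let_def by auto
  have rm: "r \<le> m" and rn: "r \<le> n" using svd_thin[OF svd M r(1)[symmetric]] by blast+
  then have m: "0 < m" and n: "0 < n" using r by auto
  have U: "?U \<in> carrier_mat m r" "transpose_mat ?U * ?U = 1\<^sub>m r"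
    and V: "?V \<in> carrier_mat n r" "transpose_mat ?V * ?V = 1\<^sub>m r"
    using first_cols_carrier first_cols_orthonormal W Z rm rn by auto
  \<comment> \<open>\<open>F\<close> is the failure of the column sample and \<open>H i\<close> that
    of the row sample for column \<open>i\<close>. The space draws a row list for every column,
    including the sampled ones, so \<open>H i\<close> makes sense for all
    \<open>i < n\<close>.\<close>
  define F where "F = {(idx :: nat \<Rightarrow> nat, Os :: nat \<Rightarrow> nat list). nonspanning r (\<lambda>i a. ?V $$ (i, a)) (idx ` {..<d})}"
  define H where "H = (\<lambda>i. {(idx :: nat \<Rightarrow> nat, Os :: nat \<Rightarrow> nat list). nonspanning r (\<lambda>i a. ?U $$ (i, a)) (set (Os i))})"
  define good where "good = {(idx, Os). mcnus_success M r d P idx Os}"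

  have p_le: "?p \<le> pmf P i" if "i < n" for i by (rule Min_le) (use that in auto)
  have "?p \<in> pmf P ` {..<n}" by (rule Min_in) (use n in auto)
  then obtain i0 where i0: "?p = pmf P i0" "i0 \<in> set_pmf P" unfolding P by (rule imageE)
  have p_pos: "0 < ?p" unfolding i0(1) by (rule pmf_positive[OF i0(2)])
  \<comment> \<open>Taking \<open>\<beta>\<close> as \<open>2 * real r / \<delta>\<close> spends
    half of \<open>\<delta>\<close> on the columns.\<close>
  have "measure_pmf.prob ?\<Omega> F \<le> real r / (2 * real r / \<delta>)"
    unfolding F_def prob_mcnus_columns[where R = "nonspanning r (\<lambda>i a. ?V $$ (i, a))"]
  proof (rule prob_nonspanning_rows[OF V r(2) incoherence_bounds(2)[OF M r(2)] P p_le p_pos])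
    show "1 \<le> 2 * real r / \<delta>" using \<delta> r(2) by (simp add: field_simps)
    show "7 * (?\<mu> * real r / real n) * ln (2 * real r / \<delta>) / ?p \<le> real d"
      using assms(11) by (simp add: mult_ac)
  qed
  also have "\<dots> = \<delta> / 2" using r by simp
  finally have F: "measure_pmf.prob ?\<Omega> F \<le> \<delta> / 2" .

  have H: "measure_pmf.prob ?\<Omega> (H i) \<le> \<delta> / (2 * real n)" if i: "i < n" for i
  proof -
    have ne: "{..<m} \<noteq> {}" using m by auto
    \<comment> \<open>The extra factor \<open>n\<close> in \<open>\<beta>\<close> splits the other
      half of \<open>\<delta>\<close> evenly among the \<open>n\<close> row samples.\<close>
    have "measure_pmf.prob ?\<Omega> (H i) \<le> real r / (2 * real r * real n / \<delta>)"
      unfolding H_def prob_mcnus_entries[OF i m, where R = "\<lambda>Ob. nonspanning r (\<lambda>i a. ?U $$ (i, a)) (set Ob)"]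
    proof (rule prob_nonspanning_rows[OF U r(2) incoherence_bounds(1)[OF M r(2)], where q = "1 / real m"])
      show "set_pmf (pmf_of_set {..<m}) = {..<m}" using ne by simp
      show "1 / real m \<le> pmf (pmf_of_set {..<m}) i" if "i < m" for i using ne that by simp
      show "0 < 1 / real m" using m by simp
      have "\<delta> \<le> 1 * 1" using \<delta> by simp
      also have "\<dots> \<le> (2 * real r) * real n" by (rule mult_mono) (use r n in auto)
      finally show "1 \<le> 2 * real r * real n / \<delta>" using \<delta> by simp
      show "7 * (?\<mu> * real r / real m) * ln (2 * real r * real n / \<delta>) / (1 / real m) \<le> real s"
        using assms(12) m by (simp add: mult_ac)
    qed
    also have "\<dots> = \<delta> / (2 * real n)" using r by simp
    finally show ?thesis .
  qed

  \<comment> \<open>Spanning gives success only on the support; \<open>measure_Int_set_pmf\<close>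
    later lifts this restriction without changing the probability.\<close>
  have "(UNIV - good) \<inter> set_pmf ?\<Omega> \<subseteq> F \<union> (\<Union>i<n. H i)"
    using mcnus_success_of_spanning[OF M svd r(1) P m]
    unfolding good_def F_def H_def by blast
  then have "measure_pmf.prob ?\<Omega> ((UNIV - good) \<inter> set_pmf ?\<Omega>) \<le> measure_pmf.prob ?\<Omega> (F \<union> (\<Union>i<n. H i))"
    by (intro measure_pmf.finite_measure_mono) auto
  moreover have "measure_pmf.prob ?\<Omega> (F \<union> (\<Union>i<n. H i))
      \<le> measure_pmf.prob ?\<Omega> F + measure_pmf.prob ?\<Omega> (\<Union>i<n. H i)"
    by (rule measure_Un_le) auto
  moreover have "measure_pmf.prob ?\<Omega> (\<Union>i<n. H i) \<le> (\<Sum>i<n. measure_pmf.prob ?\<Omega> (H i))"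
    by (rule measure_pmf.finite_measure_subadditive_finite) auto
  moreover have "(\<Sum>i<n. measure_pmf.prob ?\<Omega> (H i)) \<le> (\<Sum>i<n. \<delta> / (2 * real n))"
    by (intro sum_mono H) auto
  moreover have "(\<Sum>i<n. \<delta> / (2 * real n)) = \<delta> / 2" using n by simp
  ultimately have "measure_pmf.prob ?\<Omega> (UNIV - good) \<le> \<delta>"
    using F unfolding measure_Int_set_pmf by linarith
  moreover have "measure_pmf.prob ?\<Omega> (UNIV - good) = 1 - measure_pmf.prob ?\<Omega> good"
    using measure_pmf.prob_compl[of good ?\<Omega>] by simp
  ultimately show ?thesis unfolding good_def by linarith
qed

end
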